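(* Let $\Phi=(D,\varphi)$ be a $\mathbb{T}$-gain digraph whose underlying digraph $D$ is strongly connected. Then $0$ is an eigenvalue of $Q(\Phi)$ if and only if $\Phi$ is cycle antibalanced. Moreover, when these conditions hold, $Q(\Phi)$ is cospectral with $L(D)$.
   Context: A digraph $D=(V,\mathcal{A})$ has a finite vertex set $V=\{v_1,\dots,v_n\}$ and a set $\mathcal{A}$ of ordered pairs of distinct vertices, called arcs (no loops; at most one arc from $v_i$ to $v_j$ for each ordered pair; opposite arcs may both be present). The out-degree $\deg^+(v)$ is the number of arcs leaving $v$. A directed cycle is a closed directed walk whose vertices are distinct except that the first and last coincide (so its length is at least $2$; length $2$ is allowed). $D$ is strongly connected if every ordered pair of vertices is joined by a directed path. Let $\mathbb{T}=\{z\in\mathbb{C}:|z|=1\}$. A $\mathbb{T}$-gain digraph is a pair $\Phi=(D,\varphi)$ with $\varphi:\mathcal{A}\to\mathbb{T}$ an arbitrary function (no relation between gains of opposite arcs). Its gain adjacency matrix $A(\Phi)$ has entries $A(\Phi)_{ij}=\varphi(v_i,v_j)$ if $(v_i,v_j)\in\mathcal{A}$ and $0$ otherwise; $A(D)$ is the $0/1$ adjacency matrix of $D$ (all gains $1$). With $D^+=\operatorname{diag}(\deg^+(v_1),\dots,\deg^+(v_n))$, the signless Laplacian is $Q(\Phi)=D^++A(\Phi)$, and the Laplacian of $D$ is $L(D)=D^+-A(D)$. The gain $\varphi(C)$ of a directed cycle is the product of the gains of its arcs; $\Phi$ is cycle antibalanced if $\varphi(C)=(-1)^{\ell(C)}$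 for every directed cycle $C$ of $D$, where $\ell(C)$ is the length of $C$. Two matrices are cospectral if they have the same characteristic polynomial. *)

theory Defs
  imports
    Complex_Main
    "Graph_Theory.Pair_Digraph"
    "Graph_Theory.Digraph_Component"
    "Jordan_Normal_Form.Char_Poly"
begin

text \<open>
  The underlying digraph is a \<^locale>\<open>pair_digraph\<close>: finite, loop-free, with arcs given as ordered
  pairs of vertices. The gain function is constrained on arcs only; its values on other pairs are
  never used, and the gains of opposite arcs are unrelated.
\<close>

locale gain_digraph = pair_digraph D
  for D :: "'v pair_pre_digraph" +
  fixes \<phi> :: "'v \<times> 'v \<Rightarrow> complex"
  assumes norm_gain: "e \<in> parcs D \<Longrightarrow> norm (\<phi> e) = 1"

text \<open>
  In the matrices below, \<open>vs\<close> lists the vertices without repetition, so that the vertex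
  called \<open>v\<^sub>i\<close> (counting from 1) in the usual notation is \<open>vs ! (i - 1)\<close>. The \<open>0/1\<close> adjacency
  matrix and the Laplacian are taken over the complex numbers, so that their characteristic
  polynomials can be compared with those of gain matrices.
\<close>

definition gain_adj_mat :: "'v pair_pre_digraph \<Rightarrow> ('v \<times> 'v \<Rightarrow> complex) \<Rightarrow> 'v list \<Rightarrow> complex mat" where
  "gain_adj_mat D \<phi> vs = mat (length vs) (length vs)
     (\<lambda>(i, j). if (vs ! i, vs ! j) \<in> parcs D then \<phi> (vs ! i, vs ! j) else 0)"

definition adj_mat :: "'v pair_pre_digraph \<Rightarrow> 'v list \<Rightarrow> complex mat" where
  "adj_mat D vs = gain_adj_mat D (\<lambda>e. 1) vs"

definition out_degree_mat :: "'v pair_pre_digraph \<Rightarrow> 'v list \<Rightarrow> complex mat" where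
  "out_degree_mat D vs = mat_diag (length vs) (\<lambda>i. of_nat (out_degree (with_proj D) (vs ! i)))"

definition signless_laplacian :: "'v pair_pre_digraph \<Rightarrow> ('v \<times> 'v \<Rightarrow> complex) \<Rightarrow> 'v list \<Rightarrow> complex mat" where
  "signless_laplacian D \<phi> vs = out_degree_mat D vs + gain_adj_mat D \<phi> vs"

definition laplacian :: "'v pair_pre_digraph \<Rightarrow> 'v list \<Rightarrow> complex mat" where
  "laplacian D vs = out_degree_mat D vs - adj_mat D vs"

definition walk_gain :: "('v \<times> 'v \<Rightarrow> complex) \<Rightarrow> ('v \<times> 'v) list \<Rightarrow> complex" where
  "walk_gain \<phi> p = prod_list (map \<phi> p)"

text \<open>
  A cycle is represented by its list of arcs, so its length is the length of the list. Each
  rotation of a cycle is again a cycle in the sense of \<^const>\<open>pre_digraph.cycle\<close>, with the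
  same gain and length. The minimal length there is 1, but loop-freeness excludes length 1.
\<close>

definition cycle_antibalanced :: "'v pair_pre_digraph \<Rightarrow> ('v \<times> 'v \<Rightarrow> complex) \<Rightarrow> bool" where
  "cycle_antibalanced D \<phi> \<longleftrightarrow>
     (\<forall>C. pre_digraph.cycle (with_proj D) C \<longrightarrow> walk_gain \<phi> C = (-1) ^ length C)"

definition cospectral :: "complex mat \<Rightarrow> complex mat \<Rightarrow> bool" where
  "cospectral A B \<longleftrightarrow> char_poly A = char_poly B"

end

theory Submission
  imports Defs "HOL-Analysis.Inner_Product"
begin

text \<open>
  A zero eigenvector \<open>x\<close> of the signless Laplacian satisfies, at every vertex \<open>v\<close>, that \<open>x v\<close> is the
  average of the numbers \<open>- \<phi> (v, w) * x w\<close> over the out-neighbours \<open>w\<close>. Where the modulus of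
  \<open>x\<close> is maximal these numbers must all equal \<open>x v\<close>, so the modulus is maximal at the out-neighbours
  too, and strong connectivity propagates \<open>x v = - \<phi> (v, w) * x w\<close> to all arcs. Going once
  around a cycle shows that its gain is \<open>(-1) ^ length C\<close>. Conversely, if all cycles have this gain
  then so have all closed walks, and \<open>x v = (-1) ^ length p * walk_gain \<phi> p\<close>, for a walk \<open>p\<close> from
  \<open>v\<close> to a fixed root, does not depend on the choice of \<open>p\<close>. This \<open>x\<close> solves the arc equations, and
  conjugating the Laplacian by \<open>diag x\<close> gives the signless Laplacian.
\<close>

section \<open>Equality in the triangle inequality, and diagonal similarity\<close>

text \<open>By Cauchy-Schwarz each \<open>inner x (f b)\<close> is at most \<open>inner x x\<close>,
  and the value of the sum forces equality for every \<open>b\<close>. With the norm bound,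
  expanding \<open>inner (f a - x) (f a - x)\<close> then leaves at most 0.\<close>

lemma sum_eq_card_scaleR_imp_eq:
  fixes f :: "'a \<Rightarrow> 'b :: real_inner"
  assumes fin: "finite A" and le: "\<And>a. a \<in> A \<Longrightarrow> norm (f a) \<le> norm x"
    and sum: "sum f A = real (card A) *\<^sub>R x" and a: "a \<in> A"
  shows "f a = x"
proof -
  have le': "inner x (f b) \<le> inner x x" if "b \<in> A" for b
  proof -
    have "inner x (f b) \<le> norm x * norm (f b)" by (rule norm_cauchy_schwarz)
    also have "\<dots> \<le> norm x * norm x" using le[OF that] by (simp add: mult_left_mono)
    finally show ?thesis by (simp add: dot_square_norm power2_eq_square)
  qed
  have "(\<Sum>b\<in>A. inner x x - inner x (f b)) = 0"
    by (simp add: sum_subtractf sum inner_sum_right[symmetric])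
  then have eq: "inner x (f a) = inner x x"
    using sum_nonneg_eq_0_iff[OF fin, of "\<lambda>b. inner x x - inner x (f b)"] le' a by auto
  have "inner (f a) (f a) \<le> inner x x"
    unfolding dot_square_norm using le[OF a] by (rule power_mono) simp
  then have "inner (f a - x) (f a - x) \<le> 0"
    using eq by (simp add: inner_diff_left inner_diff_right inner_commute)
  then show ?thesis by (metis eq_iff_diff_eq_0 inner_eq_zero_iff inner_ge_zero order_antisym)
qed

lemma similar_mat_mat_diag_conj:
  fixes A :: "'a :: field mat"
  assumes A: "A \<in> carrier_mat n n" and B: "B \<in> carrier_mat n n"
    and d: "\<And>i. i < n \<Longrightarrow> d i \<noteq> 0"
    and eq: "\<And>i j. i < n \<Longrightarrow> j < n \<Longrightarrow> A $$ (i, j) = d i * B $$ (i, j) / d j"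
  shows "similar_mat A B"
proof (rule similar_matI)
  let ?P = "mat_diag n d" and ?Q = "mat_diag n (\<lambda>i. inverse (d i))"
  show "{A, B, ?P, ?Q} \<subseteq> carrier_mat n n" using A B by auto
  show "?P * ?Q = 1\<^sub>m n" "?Q * ?P = 1\<^sub>m n"
    unfolding mat_diag_diag using d by (auto simp: mat_diag_def intro!: eq_matI)
  show "A = ?P * B * ?Q"
  proof (rule eq_matI)
    fix i j assume "i < dim_row (?P * B * ?Q)" "j < dim_col (?P * B * ?Q)"
    then have ij: "i < n" "j < n" by (auto simp: mat_diag_def)
    have "(?P * B * ?Q) $$ (i, j) = (?P * B) $$ (i, j) * inverse (d j)"
      using ij by (subst mat_diag_mult_right[OF mult_carrier_mat[OF mat_diag_dim B]]) auto
    also have "(?P * B) $$ (i, j) = d i * B $$ (i, j)"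
      using ij by (subst mat_diag_mult_left[OF B]) auto
    finally show "A $$ (i, j) = (?P * B * ?Q) $$ (i, j)"
      using ij eq by (simp add: divide_inverse)
  qed (use A in \<open>auto simp: mat_diag_def\<close>)
qed

section \<open>Potentials and gains of closed walks\<close>

lemma walk_gain_Nil [simp]: "walk_gain \<phi> [] = 1"
  and walk_gain_Cons [simp]: "walk_gain \<phi> (e # p) = \<phi> e * walk_gain \<phi> p"
  and walk_gain_append [simp]: "walk_gain \<phi> (p @ q) = walk_gain \<phi> p * walk_gain \<phi> q"
  by (simp_all add: walk_gain_def)

context gain_digraph
begin

text \<open>In gain graph terms \<open>x\<close> is a switching function: it writes each gain as
  \<open>- x v / x w\<close>, so that switching by \<open>x\<close> turns all gains into -1. Zero
  eigenvectors and antibalance are linked through its existence.\<close>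

definition potential :: "('v \<Rightarrow> complex) \<Rightarrow> bool" where
  "potential x \<longleftrightarrow>
    (\<forall>v w. (v, w) \<in> parcs D \<longrightarrow> x v = - \<phi> (v, w) * x w) \<and> (\<forall>v\<in>pverts D. x v \<noteq> 0)"

lemma potentialD:
  assumes "potential x"
  shows "(v, w) \<in> parcs D \<Longrightarrow> x v = - \<phi> (v, w) * x w" and "v \<in> pverts D \<Longrightarrow> x v \<noteq> 0"
  using assms unfolding potential_def by meson+

lemma awalk_potential:
  assumes "potential x"
    and "awalk u p v"
  shows "x u = (- 1) ^ length p * walk_gain \<phi> p * x v"
  using assms(2)
proof (induction p arbitrary: u)
  case (Cons e p)
  then show ?case using potentialD(1)[OF assms(1), of u "snd e"] by (cases e) (auto simp: awalk_Cons_iff)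
qed (auto simp: awalk_Nil_iff)

lemma potential_imp_cycle_antibalanced:
  assumes pot: "potential x"
  shows "cycle_antibalanced D \<phi>"
  unfolding cycle_antibalanced_def
proof (intro allI impI)
  fix C assume "cycle C"
  then obtain u where C: "awalk u C u" by (auto simp: cycle_def)
  then have "x u \<noteq> 0" using potentialD(2)[OF pot] by auto
  then have "(- 1) ^ length C * walk_gain \<phi> C = 1"
    using awalk_potential[OF pot C] by simp
  then show "walk_gain \<phi> C = (- 1) ^ length C"
    by (metis minus_one_power_iff mult_1 mult_minus1 add.inverse_inverse)
qed

text \<open>Gain and sign are both multiplicative, so a closed walk that is not a cycle can be cut
  into two shorter closed walks and treated by induction on the length.\<close>

lemma closed_awalk_gain:
  assumes "cycle_antibalanced D \<phi>" and "awalk u p u"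
  shows "walk_gain \<phi> p = (- 1) ^ length p"
  using assms(2)
proof (induction "length p" arbitrary: u p rule: less_induct)
  case less
  show ?case
  proof (cases p)
    case (Cons e es)
    show ?thesis
    \<comment> \<open>\<open>cycle\<close> requires distinctness of all vertices of the walk but the
      first, which are exactly the vertices of \<open>es\<close>.\<close>
    proof (cases "distinct (pawalk_verts (snd e) es)")
      case True
      then have "cycle p" using less.prems Cons by (auto simp: cycle_def)
      then show ?thesis using assms(1) by (auto simp: cycle_antibalanced_def)
    next
      case False
      have "awalk (snd e) es u" using less.prems Cons by (auto simp: awalk_Cons_iff)
      \<comment> \<open>Splitting \<open>es\<close> instead of \<open>p\<close> leaves
        \<open>e\<close> outside the loop \<open>r\<close>, so \<open>r\<close> is shorter than
        \<open>p\<close>; as \<open>r\<close> is nonempty, \<open>e # q @ s\<close> is shorter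
        too.\<close>
      from awalk_not_distinct_decomp[OF this False] obtain q r s w where
        es: "es = q @ r @ s" and r: "r \<noteq> []" "awalk w r w"
        and qs: "awalk (snd e) q w" "awalk w s u"
        using \<open>awalk (snd e) es u\<close> by (auto dest: awalk_ends)
      have "awalk u (e # q @ s) u"
        using less.prems Cons qs by (auto simp: awalk_Cons_iff awalk_appendI)
      from less.hyps[OF _ this] have "walk_gain \<phi> (e # q @ s) = (- 1) ^ length (e # q @ s)"
        using Cons es r by simp
      moreover have "walk_gain \<phi> r = (- 1) ^ length r"
        using less.hyps[OF _ r(2)] Cons es by simp
      moreover have "walk_gain \<phi> p = walk_gain \<phi> (e # q @ s) * walk_gain \<phi> r"
        by (simp add: Cons es)
      moreover have "length p = length (e # q @ s) + length r" by (simp add: Cons es)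
      ultimately show ?thesis by (simp only: power_add)
    qed
  qed simp
qed

lemma cycle_antibalanced_imp_potential:
  assumes anti: "cycle_antibalanced D \<phi>" and conn: "strongly_connected (with_proj D)"
  obtains x where "potential x"
proof -
  have reach: "\<exists>p. awalk u p v" if "u \<in> pverts D" "v \<in> pverts D" for u v
    using conn that by (auto simp: strongly_connected_def reachable_awalk)
  obtain r where r: "r \<in> pverts D" using conn by (auto simp: strongly_connected_def)
  define g where "g p = (- 1) ^ length p * walk_gain \<phi> p" for p
  define x where "x v = g (SOME p. awalk v p r)" for v
  have g_append: "g (p @ q) = g p * g q" for p q by (simp add: g_def power_add mult_ac)
  have g_closed: "g p = 1" if "awalk u p u" for u p
    using closed_awalk_gain[OF anti that] by (simp add: g_def flip: power_mult_distrib)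
  \<comment> \<open>A return walk from the root closes \<open>p\<close>, so its value is inverse to
    \<open>g p\<close>. This yields both independence of the chosen walk and
    \<open>x v \<noteq> 0\<close>.\<close>
  have inv: "\<exists>q. awalk r q v \<and> g p * g q = 1" if p: "awalk v p r" for v p
  proof -
    have "v \<in> pverts D" using p by auto
    then obtain q where "awalk r q v" using reach r by blast
    then show ?thesis using p g_closed[of v "p @ q"] by (auto simp: g_append)
  qed
  have x: "x v = g p" if p: "awalk v p r" for v p
  proof -
    define p' where "p' = (SOME p. awalk v p r)"
    have p': "awalk v p' r" unfolding p'_def using p by (rule someI)
    obtain q where q: "awalk r q v" "g p * g q = 1" using inv[OF p] by blast
    \<comment> \<open>The same return walk \<open>q\<close> closes \<open>p'\<close>, so
      \<open>g p\<close> and \<open>g p'\<close> are both inverse to \<open>g q\<close>.\<close>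
    then have "g p' * g q = 1" using p' g_closed[of v "p' @ q"] by (auto simp: g_append)
    then show ?thesis using q(2) unfolding x_def p'_def[symmetric]
      by (metis mult_cancel_right mult_zero_right zero_neq_one)
  qed
  have "x v = - \<phi> (v, w) * x w" if vw: "(v, w) \<in> parcs D" for v w
  proof -
    obtain p where p: "awalk w p r" using reach r vw by (meson in_arcsD2)
    then have "awalk v ((v, w) # p) r" using vw by (auto simp: awalk_Cons_iff)
    then show ?thesis using p by (simp add: x g_def)
  qed
  moreover have "x v \<noteq> 0" if v: "v \<in> pverts D" for v
  proof -
    obtain p where p: "awalk v p r" using reach r v by blast
    then show ?thesis using inv[OF p] x[OF p] by auto
  qed
  ultimately have "potential x" unfolding potential_def by blast
  then show ?thesis by (rule that)
qed

section \<open>Kernel vectors and potentials\<close>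

text \<open>A maximum principle: equality in the triangle inequality holds at vertices of maximal
  modulus, and strong connectivity makes every vertex one. The nonzero value at \<open>u\<close>
  makes this maximum positive.\<close>

lemma kernel_imp_potential:
  assumes conn: "strongly_connected (with_proj D)"
    and ker: "\<And>v. v \<in> pverts D \<Longrightarrow>
      of_nat (out_degree (with_proj D) v) * x v + (\<Sum>e\<in>out_arcs (with_proj D) v. \<phi> e * x (snd e)) = 0"
    and nz: "u \<in> pverts D" "x u \<noteq> 0"
  shows "potential x"
proof -
  define M where "M = Max ((\<lambda>v. norm (x v)) ` pverts D)"
  have le_M: "norm (x v) \<le> M" if "v \<in> pverts D" for v
    using that pair_finite_verts by (simp add: M_def)
  have "M \<in> (\<lambda>v. norm (x v)) ` pverts D"
    unfolding M_def using nz(1) pair_finite_verts by (intro Max_in) auto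
  then obtain m where m: "m \<in> pverts D" "norm (x m) = M" by auto
  have step: "x v = - \<phi> (v, w) * x w"
    if v: "norm (x v) = M" and vw: "(v, w) \<in> parcs D" for v w
  proof -
    let ?O = "out_arcs (with_proj D) v"
    have "- \<phi> (v, w) * x (snd (v, w)) = x v"
    proof (rule sum_eq_card_scaleR_imp_eq[where A = ?O and f = "\<lambda>e. - \<phi> e * x (snd e)"])
      show "finite ?O" by (rule finite_out_arcs)
      show "norm (- \<phi> e * x (snd e)) \<le> norm (x v)" if "e \<in> ?O" for e
        using that v le_M arc_snd_in_verts norm_gain by (auto simp: out_arcs_def norm_mult)
      show "(\<Sum>e\<in>?O. - \<phi> e * x (snd e)) = real (card ?O) *\<^sub>R x v"
        using ker[of v] vw in_arcsD1[OF vw]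
        by (simp add: out_degree_def sum_negf scaleR_conv_of_real add_eq_0_iff2)
      show "(v, w) \<in> ?O" using vw by (simp add: out_arcs_def)
    qed
    then show ?thesis by simp
  qed
  \<comment> \<open>Gains have modulus 1, so the arc equation carries the modulus \<open>M\<close>
    from the tail of an arc to its head; walks are therefore extended at their end.\<close>
  have max: "norm (x v) = M" if "awalk m p v" for p v
    using that
  proof (induction p arbitrary: v rule: rev_induct)
    case Nil
    then show ?case using m by (simp add: awalk_Nil_iff)
  next
    case (snoc e p)
    obtain a b where e: "e = (a, b)" by fastforce
    with snoc.prems have "awalk m p a" "(a, b) \<in> parcs D" "b = v"
      by (auto simp: awalk_simps)
    then show ?case
      using step[of a b] snoc.IH[of a] norm_gain[of "(a, b)"] by (simp add: norm_mult)
  qed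
  have all_max: "norm (x v) = M" if "v \<in> pverts D" for v
  proof -
    have "m \<rightarrow>\<^sup>*\<^bsub>with_proj D\<^esub> v" using conn that m(1) by (auto simp: strongly_connected_def)
    then show ?thesis using max by (auto simp: reachable_awalk)
  qed
  show ?thesis
    unfolding potential_def
  proof (intro conjI allI impI ballI)
    show "x v = - \<phi> (v, w) * x w" if "(v, w) \<in> parcs D" for v w
      using that by (intro step all_max in_arcsD1)
    show "x v \<noteq> 0" if "v \<in> pverts D" for v
      using all_max[OF that] all_max[OF nz(1)] nz(2) by auto
  qed
qed

lemma potential_imp_kernel:
  assumes "potential x"
  shows "of_nat (out_degree (with_proj D) v) * x v
    + (\<Sum>e\<in>out_arcs (with_proj D) v. \<phi> e * x (snd e)) = 0"
proof -
  have "(\<Sum>e\<in>out_arcs (with_proj D) v. \<phi> e * x (snd e)) = (\<Sum>e\<in>out_arcs (with_proj D) v. - x v)"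
  proof (rule sum.cong)
    fix e assume "e \<in> out_arcs (with_proj D) v"
    then show "\<phi> e * x (snd e) = - x v" using potentialD(1)[OF assms, of v "snd e"]
      by (cases e) (simp add: out_arcs_def)
  qed simp
  then show ?thesis by (simp add: out_degree_def)
qed

section \<open>Translation between matrices over \<open>vs\<close> and functions on vertices\<close>

lemma signless_laplacian_mult_vec_index:
  assumes vs: "distinct vs" "set vs = pverts D" and i: "i < length vs"
  shows "(signless_laplacian D \<phi> vs *\<^sub>v vec (length vs) (\<lambda>i. x (vs ! i))) $ i =
    of_nat (out_degree (with_proj D) (vs ! i)) * x (vs ! i)
      + (\<Sum>e\<in>out_arcs (with_proj D) (vs ! i). \<phi> e * x (snd e))"
proof -
  let ?n = "length vs" and ?v = "vs ! i"
  let ?f = "\<lambda>w. if (?v, w) \<in> parcs D then \<phi> (?v, w) * x w else 0"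
  let ?d = "of_nat (out_degree (with_proj D) ?v) :: complex"
  have "(signless_laplacian D \<phi> vs *\<^sub>v vec ?n (\<lambda>i. x (vs ! i))) $ i =
      (\<Sum>j = 0..<?n. (if i = j then ?d * x ?v else 0) + ?f (vs ! j))"
    using i by (auto simp: signless_laplacian_def out_degree_mat_def gain_adj_mat_def
        mat_diag_def scalar_prod_def algebra_simps intro!: sum.cong)
  also have "\<dots> = ?d * x ?v + (\<Sum>j = 0..<?n. ?f (vs ! j))"
    using i by (simp add: sum.distrib)
  also have "(\<Sum>j = 0..<?n. ?f (vs ! j)) = (\<Sum>w\<in>pverts D. ?f w)"
    using vs by (intro sum.reindex_bij_betw) (simp add: bij_betw_nth atLeast0LessThan)
  also have "\<dots> = (\<Sum>w | w \<in> pverts D \<and> (?v, w) \<in> parcs D. \<phi> (?v, w) * x w)"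
    using pair_finite_verts by (simp add: sum.inter_filter)
  also have "\<dots> = (\<Sum>e\<in>out_arcs (with_proj D) ?v. \<phi> e * x (snd e))"
    by (rule sum.reindex_bij_witness[of _ snd "Pair ?v"]) (auto simp: out_arcs_def in_arcsD2)
  finally show ?thesis .
qed

lemma eigenvalue_signless_laplacian_0_iff:
  assumes vs: "distinct vs" "set vs = pverts D"
  shows "eigenvalue (signless_laplacian D \<phi> vs) 0 \<longleftrightarrow>
    (\<exists>x. (\<exists>u\<in>pverts D. x u \<noteq> 0) \<and> (\<forall>v\<in>pverts D.
      of_nat (out_degree (with_proj D) v) * x v
        + (\<Sum>e\<in>out_arcs (with_proj D) v. \<phi> e * x (snd e)) = 0))"
    (is "_ \<longleftrightarrow> (\<exists>x. ?nz x \<and> ?ker x)")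
proof -
  let ?n = "length vs" and ?Q = "signless_laplacian D \<phi> vs"
  let ?vec = "\<lambda>x. vec ?n (\<lambda>i. x (vs ! i)) :: complex vec"
  have dim: "dim_row ?Q = ?n" "dim_col ?Q = ?n"
    by (simp_all add: signless_laplacian_def gain_adj_mat_def)
  have vec_iff: "eigenvector ?Q (?vec x) 0 \<longleftrightarrow> ?nz x \<and> ?ker x" for x
  proof -
    have "?vec x \<noteq> 0\<^sub>v ?n \<longleftrightarrow> ?nz x"
      by (auto simp: vec_eq_iff set_conv_nth simp flip: vs(2))
    moreover have "?Q *\<^sub>v ?vec x = 0 \<cdot>\<^sub>v ?vec x \<longleftrightarrow> (\<forall>i<?n. (?Q *\<^sub>v ?vec x) $ i = 0)"
      by (auto simp: vec_eq_iff dim)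
    moreover have "\<dots> \<longleftrightarrow> ?ker x"
      unfolding vs(2)[symmetric]
      by (simp add: signless_laplacian_mult_vec_index[OF vs] all_set_conv_all_nth del: index_mult_mat_vec)
    ultimately show ?thesis by (simp add: eigenvector_def dim)
  qed
  show ?thesis
  proof
    assume "eigenvalue ?Q 0"
    then obtain z where z: "eigenvector ?Q z 0" by (auto simp: eigenvalue_def)
    \<comment> \<open>The entry of \<open>z\<close> at the position of \<open>v\<close> in
      \<open>vs\<close>; this position is unique because \<open>vs\<close> is distinct.\<close>
    let ?x = "\<lambda>v. z $ (inv_into {..<?n} ((!) vs) v)"
    have "z = ?vec ?x"
      using z vs(1) by (auto simp: eigenvector_def dim vec_eq_iff inv_into_f_f inj_on_nth)
    with z have "eigenvector ?Q (?vec ?x) 0"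
      by (rule back_subst[where P = "\<lambda>z. eigenvector ?Q z 0"])
    then have "?nz ?x \<and> ?ker ?x" by (rule iffD1[OF vec_iff])
    then show "\<exists>x. ?nz x \<and> ?ker x" by (rule exI[where x = ?x])
  next
    assume "\<exists>x. ?nz x \<and> ?ker x"
    then obtain x where "?nz x \<and> ?ker x" ..
    then have "eigenvector ?Q (?vec x) 0" by (rule iffD2[OF vec_iff])
    then show "eigenvalue ?Q 0" unfolding eigenvalue_def by (rule exI)
  qed
qed

text \<open>The arc equation gives \<open>\<phi> (v, w) = x v * (-1) / x w\<close>, so conjugation
  by \<open>diag x\<close> turns the off-diagonal entries of the Laplacian into gains and fixes its
  diagonal.\<close>

lemma potential_imp_cospectral:
  assumes pot: "potential x"
    and vs: "distinct vs" "set vs = pverts D"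
  shows "cospectral (signless_laplacian D \<phi> vs) (laplacian D vs)"
  unfolding cospectral_def
proof (rule char_poly_similar,
    rule similar_mat_mat_diag_conj[where n = "length vs" and d = "\<lambda>i. x (vs ! i)"])
  let ?n = "length vs"
  show "signless_laplacian D \<phi> vs \<in> carrier_mat ?n ?n"
    by (rule carrier_matI) (simp_all add: signless_laplacian_def gain_adj_mat_def)
  show "laplacian D vs \<in> carrier_mat ?n ?n"
    by (rule carrier_matI) (simp_all add: laplacian_def adj_mat_def gain_adj_mat_def)
  show nz': "x (vs ! i) \<noteq> 0" if "i < ?n" for i
    using that by (intro potentialD(2)[OF pot]) (simp flip: vs(2))
  show "signless_laplacian D \<phi> vs $$ (i, j) = x (vs ! i) * laplacian D vs $$ (i, j) / x (vs ! j)"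
    if ij: "i < ?n" "j < ?n" for i j
  proof (cases "i = j")
    case True
    \<comment> \<open>Without loops both diagonals consist of the out-degrees alone.\<close>
    have "(vs ! i, vs ! i) \<notin> parcs D" using no_loops' by blast
    then show ?thesis using True ij nz'[OF ij(1)]
      by (simp add: signless_laplacian_def laplacian_def adj_mat_def gain_adj_mat_def
          out_degree_mat_def mat_diag_def)
  next
    case False
    have "\<phi> (vs ! i, vs ! j) = - (x (vs ! i) / x (vs ! j))" if "(vs ! i, vs ! j) \<in> parcs D"
      using potentialD(1)[OF pot that] nz'[OF ij(2)] by (simp add: divide_simps)
    then show ?thesis using False ij
      by (simp add: signless_laplacian_def laplacian_def adj_mat_def gain_adj_mat_def
          out_degree_mat_def mat_diag_def)
  qed
qed

section \<open>The equivalence and cospectrality\<close>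

lemma eigenvalue_0_imp_cycle_antibalanced:
  assumes conn: "strongly_connected (with_proj D)"
    and vs: "distinct vs" "set vs = pverts D"
    and ev: "eigenvalue (signless_laplacian D \<phi> vs) 0"
  shows "cycle_antibalanced D \<phi>"
proof -
  from ev[unfolded eigenvalue_signless_laplacian_0_iff[OF vs]] obtain x where
    nz: "\<exists>u\<in>pverts D. x u \<noteq> 0" and ker: "\<forall>v\<in>pverts D.
      of_nat (out_degree (with_proj D) v) * x v
        + (\<Sum>e\<in>out_arcs (with_proj D) v. \<phi> e * x (snd e)) = 0"
    by (elim exE conjE)
  from nz obtain u where "u \<in> pverts D" "x u \<noteq> 0" by (elim bexE)
  from kernel_imp_potential[OF conn bspec[OF ker] this] show ?thesis
    by (rule potential_imp_cycle_antibalanced)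
qed

lemma cycle_antibalanced_imp_eigenvalue_0_cospectral:
  assumes conn: "strongly_connected (with_proj D)"
    and vs: "distinct vs" "set vs = pverts D"
    and anti: "cycle_antibalanced D \<phi>"
  shows "eigenvalue (signless_laplacian D \<phi> vs) 0"
    and "cospectral (signless_laplacian D \<phi> vs) (laplacian D vs)"
proof -
  obtain x where pot: "potential x"
    by (rule cycle_antibalanced_imp_potential[OF anti conn])
  \<comment> \<open>Strong connectivity includes that there is a vertex, so the potential is a
    nonzero vector.\<close>
  obtain u where "u \<in> pverts D"
    using conn by (auto simp: strongly_connected_def)
  with potentialD(2)[OF pot] have "\<exists>u\<in>pverts D. x u \<noteq> 0" by blast
  then show "eigenvalue (signless_laplacian D \<phi> vs) 0"
    unfolding eigenvalue_signless_laplacian_0_iff[OF vs]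
    by (intro exI[where x = x] conjI ballI) (assumption, rule potential_imp_kernel[OF pot])
  show "cospectral (signless_laplacian D \<phi> vs) (laplacian D vs)"
    by (rule potential_imp_cospectral[OF pot vs])
qed

end

theorem corollary5p5:
  fixes D :: "'v pair_pre_digraph"
    and \<phi> :: "'v \<times> 'v \<Rightarrow> complex"
    and vs :: "'v list"
  assumes "gain_digraph D \<phi>"
    and "strongly_connected (with_proj D)"
    and "distinct vs" and "set vs = pverts D"
  shows "(eigenvalue (signless_laplacian D \<phi> vs) 0 \<longleftrightarrow> cycle_antibalanced D \<phi>)
    \<and> (cycle_antibalanced D \<phi> \<longrightarrow> cospectral (signless_laplacian D \<phi> vs) (laplacian D vs))"
  using gain_digraph.eigenvalue_0_imp_cycle_antibalanced[OF assms]
    gain_digraph.cycle_antibalanced_imp_eigenvalue_0_cospectral[OF assms] by blast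

end
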